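(* Let $X=c_0$, or $X=\ell_p$ with $1<p<\infty$ and $p\ne2$ (complex sequence spaces indexed by $\mathbb Z_+$). The set of all $T\in\mathcal B_1(X)$ such that $T^*$ is an isometry is nowhere dense in $(\mathcal B_1(X),\mathrm{SOT})$. In particular, a typical $T\in(\mathcal B_1(X),\mathrm{SOT})$ is such that $T^*$ is not an isometry.
   Context: $\mathcal B_1(X)$ is the set of all bounded linear operators $T$ on $X$ with $\|T\|\le 1$. SOT (Strong Operator Topology) is the topology of pointwise norm convergence on $X$; $(\mathcal B_1(X),\mathrm{SOT})$ is a Polish space. "A typical $T\in(\mathcal B_1(X),\mathrm{SOT})$ satisfies (P)" means that the set of $T\in\mathcal B_1(X)$ satisfying (P) is comeager in $(\mathcal B_1(X),\mathrm{SOT})$. "Isometry" means linear norm-preserving map, not necessarily onto; $T^*$ acts on the dual $X^*$. *)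

theory Defs
  imports "HOL-Analysis.Analysis"
begin

text \<open>
  A complex normed space is given by an explicit carrier, its operations and its norm. Carriers are
  used instead of type classes because \<open>\<ell>\<^sub>p\<close> depends on a real parameter, and because the library has
  no class of complex normed spaces. Only the restriction of the operations to the carrier matters.
\<close>

record 'a nspace =
  carr :: "'a set"
  vadd :: "'a \<Rightarrow> 'a \<Rightarrow> 'a"
  vscale :: "complex \<Rightarrow> 'a \<Rightarrow> 'a"
  vnorm :: "'a \<Rightarrow> real"

text \<open>Outside the carrier the distance is set to \<open>0\<close>, because the locale \<^locale>\<open>Metric_space\<close>
  requires nonnegativity and symmetry on the whole type.\<close>

definition vdist :: "'a nspace \<Rightarrow> 'a \<Rightarrow> 'a \<Rightarrow> real" where
  "vdist X x y =
    (if x \<in> carr X \<and> y \<in> carr X then vnorm X (vadd X x (vscale X (- 1) y)) else 0)"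

definition norm_topology :: "'a nspace \<Rightarrow> 'a topology" where
  "norm_topology X = Metric_space.mtopology (carr X) (vdist X)"


definition c0 :: "(nat \<Rightarrow> complex) nspace" where
  "c0 = \<lparr> carr = {x. x \<longlonglongrightarrow> 0},
          vadd = (\<lambda>x y n. x n + y n),
          vscale = (\<lambda>a x n. a * x n),
          vnorm = (\<lambda>x. SUP n. cmod (x n)) \<rparr>"

definition lp :: "real \<Rightarrow> (nat \<Rightarrow> complex) nspace" where
  "lp p = \<lparr> carr = {x. summable (\<lambda>n. cmod (x n) powr p)},
            vadd = (\<lambda>x y n. x n + y n),
            vscale = (\<lambda>a x n. a * x n),
            vnorm = (\<lambda>x. (\<Sum>n. cmod (x n) powr p) powr (1 / p)) \<rparr>"

definition scalars :: "complex nspace" where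
  "scalars = \<lparr> carr = UNIV, vadd = (+), vscale = (*), vnorm = cmod \<rparr>"


definition linear_map :: "'a nspace \<Rightarrow> 'b nspace \<Rightarrow> ('a \<Rightarrow> 'b) \<Rightarrow> bool" where
  "linear_map X Y T \<longleftrightarrow>
    T \<in> carr X \<rightarrow> carr Y \<and>
    (\<forall>x\<in>carr X. \<forall>y\<in>carr X. T (vadd X x y) = vadd Y (T x) (T y)) \<and>
    (\<forall>a. \<forall>x\<in>carr X. T (vscale X a x) = vscale Y a (T x))"

definition isometry :: "'a nspace \<Rightarrow> 'b nspace \<Rightarrow> ('a \<Rightarrow> 'b) \<Rightarrow> bool" where
  "isometry X Y T \<longleftrightarrow> linear_map X Y T \<and> (\<forall>x\<in>carr X. vnorm Y (T x) = vnorm X x)"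

text \<open>The normed space of bounded linear maps with the operator norm. Its elements are extensional
  (equal to \<^const>\<open>undefined\<close> outside the carrier of \<open>X\<close>), so that they correspond exactly to the maps
  on the carrier.\<close>

definition bounded_maps :: "'a nspace \<Rightarrow> 'b nspace \<Rightarrow> ('a \<Rightarrow> 'b) nspace" where
  "bounded_maps X Y =
    \<lparr> carr = {T. T \<in> extensional (carr X) \<and> linear_map X Y T \<and>
                 (\<exists>C. \<forall>x\<in>carr X. vnorm Y (T x) \<le> C * vnorm X x)},
      vadd = (\<lambda>S T. \<lambda>x\<in>carr X. vadd Y (S x) (T x)),
      vscale = (\<lambda>a T. \<lambda>x\<in>carr X. vscale Y a (T x)),
      vnorm = (\<lambda>T. SUP x\<in>{x \<in> carr X. vnorm X x \<le> 1}. vnorm Y (T x)) \<rparr>"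

definition dual :: "'a nspace \<Rightarrow> ('a \<Rightarrow> complex) nspace" where
  "dual X = bounded_maps X scalars"

definition adjoint_map :: "'a nspace \<Rightarrow> ('a \<Rightarrow> 'a) \<Rightarrow> ('a \<Rightarrow> complex) \<Rightarrow> ('a \<Rightarrow> complex)" where
  "adjoint_map X T = (\<lambda>\<phi>\<in>carr (dual X). compose (carr X) \<phi> T)"

definition contractions :: "'a nspace \<Rightarrow> ('a \<Rightarrow> 'a) set" where
  "contractions X = {T \<in> carr (bounded_maps X X). vnorm (bounded_maps X X) T \<le> 1}"

definition SOT :: "'a nspace \<Rightarrow> ('a \<Rightarrow> 'a) topology" where
  "SOT X = subtopology (product_topology (\<lambda>_. norm_topology X) (carr X)) (contractions X)"


definition nowhere_dense_in :: "'a topology \<Rightarrow> 'a set \<Rightarrow> bool" where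
  "nowhere_dense_in \<tau> A \<longleftrightarrow> A \<subseteq> topspace \<tau> \<and> \<tau> interior_of (\<tau> closure_of A) = {}"

definition comeager_in :: "'a topology \<Rightarrow> 'a set \<Rightarrow> bool" where
  "comeager_in \<tau> A \<longleftrightarrow> A \<subseteq> topspace \<tau> \<and>
    (\<exists>\<N>. countable \<N> \<and> (\<forall>N\<in>\<N>. nowhere_dense_in \<tau> N) \<and> topspace \<tau> - A \<subseteq> \<Union>\<N>)"

definition typical_contraction :: "'a nspace \<Rightarrow> (('a \<Rightarrow> 'a) \<Rightarrow> bool) \<Rightarrow> bool" where
  "typical_contraction X P \<longleftrightarrow> comeager_in (SOT X) {T \<in> contractions X. P T}"

end

theory Submission
  imports Defs
begin

text \<open>
  The dual of \<open>X\<close> is \<open>\<ell>\<^sub>q\<close> with \<open>q \<noteq> 2\<close> (\<open>q = 1\<close> for \<open>c\<^sub>0\<close>), so an isometry \<open>T\<^sup>*\<close> maps the disjointly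
  supported functionals \<open>e\<^sub>i\<^sup>*\<close> to disjointly supported ones, by the equality case of Clarkson's
  inequality. Hence every \<open>T e\<^sub>j\<close> has at most one nonzero coordinate. This condition is closed in the
  strong operator topology, and it is destroyed by arbitrarily small perturbations.
\<close>

section \<open>Convexity of powers\<close>

text \<open>Let r_i be the image of the i-th coordinate functional under the adjoint. For i
  different from k, an isometry gives r_i and r_k norm 1 and gives r_i + r_k and r_i - r_k norm
  2^(1/q), so the q-th powers satisfy 2 + 2 = 2 + 2. Termwise, the two sides of Clarkson's
  inequality differ with a fixed strict sign wherever both entries are nonzero. For q = 2 the
  parallelogram law makes every term an equality, which is why 2 is excluded. Duality enters through
  one formula, \<open>dual_norm_sums\<close>, giving the norm of a functional by its values on unit
  vectors. The locale \<open>seq_space\<close> collects what that formula and the perturbation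
  require, so that c_0 and l_p share one argument. Nowhere density is read off from the column T
  e_0: at most one nonzero entry leaves two zeros among any three coordinates, and working at two
  zeros rules out cancellation between T and the perturbation. The perturbed operators are convex
  combinations of T with a rank-one contraction, hence contractions.\<close>

lemma convex_on_powr:
  fixes p :: real
  assumes p: "1 \<le> p"
  shows "convex_on {0..} (\<lambda>x. x powr p)"
proof (rule convex_onI)
  \<comment> \<open>\<open>powr_convex\<close> serves positive arguments; with an endpoint 0,
    convexity reduces to t^p \<le> t on the unit interval.\<close>
  have scaled: "(t * x) powr p \<le> t * x powr p" if "0 < t" "t < 1" "0 \<le> x" for t x :: real
  proof -
    have "t powr p \<le> t powr 1"
      using that p by (intro powr_mono') auto
    then show ?thesis
      using that by (simp add: powr_mult mult_right_mono)
  qed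
  fix t x y :: real
  assume t: "0 < t" "t < 1" and xy: "x \<in> {0..}" "y \<in> {0..}"
  show "((1 - t) *\<^sub>R x + t *\<^sub>R y) powr p \<le> (1 - t) * x powr p + t * y powr p"
  proof (cases "x = 0 \<or> y = 0")
    case True
    then show ?thesis
      using t xy p scaled[of t y] scaled[of "1 - t" x] by auto
  next
    case False
    then show ?thesis
      using convex_onD[OF powr_convex[OF p], of t x y] t xy by auto
  qed
qed simp

lemma powr_midpoint_le:
  fixes s u v :: real
  assumes "1 \<le> s" "0 \<le> u" "0 \<le> v"
  shows "2 * ((u + v) / 2) powr s \<le> u powr s + v powr s"
  using convex_onD[OF convex_on_powr, of s "1/2" u v] assms by (simp add: add_divide_distrib)

text \<open>Concavity comes from convexity of the inverse power: apply
  \<open>powr_midpoint_le\<close> with exponent 1/s to u^s and v^s, then raise to the power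
  s.\<close>

lemma powr_midpoint_ge:
  fixes s u v :: real
  assumes s: "0 < s" "s \<le> 1" and uv: "0 \<le> u" "0 \<le> v"
  shows "u powr s + v powr s \<le> 2 * ((u + v) / 2) powr s"
proof -
  have "2 * ((u powr s + v powr s) / 2) powr (1 / s) \<le> u + v"
    using powr_midpoint_le[of "1/s" "u powr s" "v powr s"] s uv by (simp add: powr_powr)
  then have "((u powr s + v powr s) / 2) powr (1 / s) \<le> (u + v) / 2"
    by simp
  then have "(((u powr s + v powr s) / 2) powr (1 / s)) powr s \<le> ((u + v) / 2) powr s"
    using s by (intro powr_mono2) auto
  then show ?thesis
    using s by (simp add: powr_powr)
qed

text \<open>Write z^s = z * z^(s-1): the second factor is strictly increasing for s > 1. For s < 1
  it is strictly decreasing, which gives \<open>powr_add_greater\<close>.\<close>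

lemma powr_add_less:
  fixes s x y :: real
  assumes "1 < s" "0 < x" "0 < y"
  shows "x powr s + y powr s < (x + y) powr s"
proof -
  have *: "z powr s = z * z powr (s - 1)" if "0 < z" for z :: real
    using that powr_add[of z 1 "s - 1"] by simp
  have "x powr (s - 1) < (x + y) powr (s - 1)" "y powr (s - 1) < (x + y) powr (s - 1)"
    using assms by (auto intro!: powr_less_mono2)
  then have "x * x powr (s - 1) + y * y powr (s - 1) < (x + y) * (x + y) powr (s - 1)"
    using assms by (simp add: distrib_right add_strict_mono)
  then show ?thesis
    using assms by (simp add: *)
qed

lemma powr_add_greater:
  fixes s x y :: real
  assumes "s < 1" "0 < x" "0 < y"
  shows "(x + y) powr s < x powr s + y powr s"
proof -
  have *: "z powr s = z * z powr (s - 1)" if "0 < z" for z :: real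
    using that powr_add[of z 1 "s - 1"] by simp
  have "(x + y) powr (s - 1) < x powr (s - 1)" "(x + y) powr (s - 1) < y powr (s - 1)"
    using assms by (auto intro!: powr_less_mono2_neg)
  then have "(x + y) * (x + y) powr (s - 1) < x * x powr (s - 1) + y * y powr (s - 1)"
    using assms by (simp add: distrib_right add_strict_mono)
  then show ?thesis
    using assms by (simp add: *)
qed

section \<open>Clarkson's inequality and its equality case\<close>

lemma norm_powr_eq_square_powr: "cmod z powr q = ((cmod z)\<^sup>2) powr (q / 2)"
  by (cases "z = 0") (auto simp: powr_powr simp flip: powr_numeral)

lemma cmod_parallelogram: "((cmod (a + b))\<^sup>2 + (cmod (a - b))\<^sup>2) / 2 = (cmod a)\<^sup>2 + (cmod b)\<^sup>2"
  unfolding cmod_power2 by (simp add: power2_eq_square algebra_simps)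

text \<open>Concavity of the power q/2 is applied to the squared moduli of a + b and a - b, whose
  mean is |a|^2 + |b|^2 by the parallelogram law. Strictness comes from the strict subadditivity of
  the same power.\<close>

lemma clarkson_less:
  fixes q :: real
  assumes q: "0 < q" "q < 2" and ab: "a \<noteq> 0" "b \<noteq> 0"
  shows "cmod (a + b) powr q + cmod (a - b) powr q < 2 * cmod a powr q + 2 * cmod b powr q"
proof -
  have "cmod (a + b) powr q + cmod (a - b) powr q
      \<le> 2 * (((cmod (a + b))\<^sup>2 + (cmod (a - b))\<^sup>2) / 2) powr (q / 2)"
    unfolding norm_powr_eq_square_powr[of _ q] using q by (intro powr_midpoint_ge) auto
  also have "\<dots> = 2 * ((cmod a)\<^sup>2 + (cmod b)\<^sup>2) powr (q / 2)"
    by (simp only: cmod_parallelogram)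
  also have "\<dots> < 2 * (((cmod a)\<^sup>2) powr (q / 2) + ((cmod b)\<^sup>2) powr (q / 2))"
    using q ab by (intro mult_strict_left_mono powr_add_greater) auto
  finally show ?thesis
    by (simp add: norm_powr_eq_square_powr[of _ q])
qed

text \<open>Here q/2 > 1, so the two estimates of \<open>clarkson_less\<close> reverse and are
  chained in the opposite order.\<close>

lemma clarkson_greater:
  fixes q :: real
  assumes q: "2 < q" and ab: "a \<noteq> 0" "b \<noteq> 0"
  shows "2 * cmod a powr q + 2 * cmod b powr q < cmod (a + b) powr q + cmod (a - b) powr q"
proof -
  have "2 * (((cmod a)\<^sup>2) powr (q / 2) + ((cmod b)\<^sup>2) powr (q / 2))
      < 2 * ((cmod a)\<^sup>2 + (cmod b)\<^sup>2) powr (q / 2)"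
    using q ab by (intro mult_strict_left_mono powr_add_less) auto
  also have "\<dots> = 2 * (((cmod (a + b))\<^sup>2 + (cmod (a - b))\<^sup>2) / 2) powr (q / 2)"
    by (simp only: cmod_parallelogram)
  also have "\<dots> \<le> cmod (a + b) powr q + cmod (a - b) powr q"
    unfolding norm_powr_eq_square_powr[of _ q] using q by (intro powr_midpoint_le) auto
  finally show ?thesis
    by (simp add: norm_powr_eq_square_powr[of _ q])
qed

lemma sums_zero_nonneg:
  fixes f :: "nat \<Rightarrow> real"
  assumes "f sums 0" "\<And>n. 0 \<le> f n"
  shows "f n = 0"
  using suminf_eq_zero_iff[of f] assms by (simp add: sums_iff)

text \<open>The termwise defects in Clarkson's inequality all have the same sign and sum to 0, so
  each of them vanishes; a strict defect is then impossible.\<close>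

lemma clarkson_sums_disjoint:
  fixes a b :: "nat \<Rightarrow> complex" and q :: real
  assumes q: "0 < q" "q \<noteq> 2"
    and a: "(\<lambda>n. cmod (a n) powr q) sums A" and b: "(\<lambda>n. cmod (b n) powr q) sums B"
    and plus: "(\<lambda>n. cmod (a n + b n) powr q) sums P"
    and minus: "(\<lambda>n. cmod (a n - b n) powr q) sums M"
    and eq: "P + M = 2 * A + 2 * B"
  shows "a n = 0 \<or> b n = 0"
proof -
  let ?f = "\<lambda>n. 2 * cmod (a n) powr q + 2 * cmod (b n) powr q
               - (cmod (a n + b n) powr q + cmod (a n - b n) powr q)"
  have f: "?f sums 0"
    using sums_diff[OF sums_add[OF sums_mult[OF a, of 2] sums_mult[OF b, of 2]]
        sums_add[OF plus minus]] eq by simp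
  have zero: "?f n = 0" if "a n = 0 \<or> b n = 0" for n
    using that q by auto
  show ?thesis
  proof (cases "q < 2")
    case True
    have "0 < ?f n" if "a n \<noteq> 0" "b n \<noteq> 0" for n
      using clarkson_less[of q "a n" "b n"] q True that by simp
    with zero have pos: "0 < ?f n \<or> ?f n = 0 \<and> (a n = 0 \<or> b n = 0)" for n
      by blast
    then have "0 \<le> ?f n" for n
      by (metis less_eq_real_def)
    then have "?f n = 0"
      by (rule sums_zero_nonneg[OF f])
    with pos[of n] show ?thesis
      by simp
  next
    case False
    have "?f n < 0" if "a n \<noteq> 0" "b n \<noteq> 0" for n
      using clarkson_greater[of q "a n" "b n"] q False that by simp
    with zero have neg: "?f n < 0 \<or> ?f n = 0 \<and> (a n = 0 \<or> b n = 0)" for n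
      by blast
    then have "0 \<le> - ?f n" for n
      by (metis less_eq_real_def neg_0_le_iff_le)
    then have "- ?f n = 0"
      by (rule sums_zero_nonneg[OF sums_minus[OF f, unfolded minus_zero]])
    with neg[of n] show ?thesis
      by simp
  qed
qed

section \<open>Bounded maps\<close>

lemma carr_bounded_maps:
  "T \<in> carr (bounded_maps X Y) \<longleftrightarrow> T \<in> extensional (carr X) \<and> linear_map X Y T \<and>
    (\<exists>C. \<forall>x\<in>carr X. vnorm Y (T x) \<le> C * vnorm X x)"
  by (simp add: bounded_maps_def)

lemma vnorm_bounded_maps:
  "vnorm (bounded_maps X Y) T = (SUP x\<in>{x \<in> carr X. vnorm X x \<le> 1}. vnorm Y (T x))"
  by (simp add: bounded_maps_def)

lemma linear_map_scale: "linear_map X Y T \<Longrightarrow> x \<in> carr X \<Longrightarrow> T (vscale X a x) = vscale Y a (T x)"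
  by (simp add: linear_map_def)

lemma linear_map_add:
  "linear_map X Y T \<Longrightarrow> x \<in> carr X \<Longrightarrow> y \<in> carr X \<Longrightarrow> T (vadd X x y) = vadd Y (T x) (T y)"
  by (simp add: linear_map_def)

lemma linear_map_carr: "linear_map X Y T \<Longrightarrow> x \<in> carr X \<Longrightarrow> T x \<in> carr Y"
  by (auto simp: linear_map_def)

text \<open>The part of the normed space axioms that allows normalising a vector; it is shared by
  \<open>scalars\<close> and every \<open>seq_space\<close>.\<close>

definition homogeneous :: "'a nspace \<Rightarrow> bool" where
  "homogeneous X \<longleftrightarrow>
    (\<forall>a. \<forall>x\<in>carr X. vscale X a x \<in> carr X \<and> vnorm X (vscale X a x) = cmod a * vnorm X x) \<and>
    (\<forall>x\<in>carr X. 0 \<le> vnorm X x)"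

lemma homogeneous_scalars: "homogeneous scalars"
  by (simp add: homogeneous_def scalars_def norm_mult)

lemma op_norm_bound:
  assumes X: "homogeneous X" and Y: "homogeneous Y"
    and T: "T \<in> carr (bounded_maps X Y)" and x: "x \<in> carr X"
  shows "vnorm Y (T x) \<le> vnorm (bounded_maps X Y) T * vnorm X x"
proof -
  obtain C where C: "\<And>x. x \<in> carr X \<Longrightarrow> vnorm Y (T x) \<le> C * vnorm X x" and lin: "linear_map X Y T"
    using T by (auto simp: carr_bounded_maps)
  have nonneg: "0 \<le> vnorm X x" if "x \<in> carr X" for x
    using X that by (simp add: homogeneous_def)
  show ?thesis
  proof (cases "vnorm X x = 0")
    case True
    then show ?thesis
      using C[OF x] by simp
  next
    case False
    with nonneg[OF x] have pos: "0 < vnorm X x"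
      by simp
    let ?a = "complex_of_real (1 / vnorm X x)"
    let ?y = "vscale X ?a x"
    have norm_a: "cmod ?a = 1 / vnorm X x"
      using pos by (simp only: norm_of_real) simp
    have y: "?y \<in> carr X" "vnorm X ?y = 1"
      using X x pos norm_a by (auto simp: homogeneous_def simp del: of_real_divide)
    \<comment> \<open>The supremum is an upper bound only once the set is known to be bounded above;
      \<bar>C\<bar> appears because the sign of \<open>C\<close> is unknown.\<close>
    have "vnorm Y (T z) \<le> \<bar>C\<bar>" if "z \<in> carr X" "vnorm X z \<le> 1" for z
    proof -
      have "C * vnorm X z \<le> \<bar>C\<bar> * 1"
        using that nonneg[OF that(1)] by (intro mult_mono) auto
      then show ?thesis
        using C[OF that(1)] by simp
    qed
    then have "bdd_above ((\<lambda>x. vnorm Y (T x)) ` {x \<in> carr X. vnorm X x \<le> 1})"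
      by (auto intro!: bdd_aboveI)
    then have "vnorm Y (T ?y) \<le> vnorm (bounded_maps X Y) T"
      unfolding vnorm_bounded_maps using y by (intro cSUP_upper) auto
    moreover have "vnorm Y (T ?y) = vnorm Y (T x) / vnorm X x"
      using Y linear_map_carr[OF lin x] norm_a
      by (simp add: linear_map_scale[OF lin x] homogeneous_def del: of_real_divide)
    ultimately show ?thesis
      using pos by (simp add: divide_le_eq)
  qed
qed

section \<open>Spaces of sequences with finitely computable dual norm\<close>

text \<open>The exponent \<open>q\<close> is that of the dual space \<open>\<ell>\<^sub>q\<close>; for \<open>c\<^sub>0\<close> it is \<open>1\<close>.\<close>

definition unit_seq :: "nat \<Rightarrow> nat \<Rightarrow> complex" where
  "unit_seq j = (\<lambda>n. if n = j then 1 else 0)"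

text \<open>\<open>hoelder\<close> and \<open>hoelder_sharp\<close> say that on finite sections the
  dual norm is the l_q norm; \<open>norm_tail\<close> makes finite sequences dense, so the sections
  determine a functional. \<open>norm_coord\<close> and \<open>norm_unit\<close> keep the coordinate
  functionals and the perturbing operator under control.\<close>

locale seq_space =
  fixes X :: "(nat \<Rightarrow> complex) nspace" and q :: real
  assumes vadd: "vadd X = (\<lambda>x y n. x n + y n)"
    and vscale: "vscale X = (\<lambda>a x n. a * x n)"
    and add_closed: "x \<in> carr X \<Longrightarrow> y \<in> carr X \<Longrightarrow> (\<lambda>n. x n + y n) \<in> carr X"
    and scale_closed: "x \<in> carr X \<Longrightarrow> (\<lambda>n. a * x n) \<in> carr X"
    and norm_scale: "x \<in> carr X \<Longrightarrow> vnorm X (\<lambda>n. a * x n) = cmod a * vnorm X x"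
    and norm_triangle:
      "x \<in> carr X \<Longrightarrow> y \<in> carr X \<Longrightarrow> vnorm X (\<lambda>n. x n + y n) \<le> vnorm X x + vnorm X y"
    and norm_coord: "x \<in> carr X \<Longrightarrow> cmod (x n) \<le> vnorm X x"
    and unit_carr: "unit_seq j \<in> carr X"
    and norm_unit: "vnorm X (unit_seq j) \<le> 1"
    and norm_tail: "x \<in> carr X \<Longrightarrow> (\<lambda>N. vnorm X (\<lambda>n. if n < N then 0 else x n)) \<longlonglongrightarrow> 0"
    and q: "0 < q" "q \<noteq> 2"
    and hoelder: "x \<in> carr X \<Longrightarrow>
      cmod (\<Sum>n<N. x n * c n) \<le> (\<Sum>n<N. cmod (c n) powr q) powr (1 / q) * vnorm X x"
    and hoelder_sharp: "\<exists>x\<in>carr X. vnorm X x \<le> 1 \<and> (\<forall>n\<ge>N. x n = 0) \<and>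
      cmod (\<Sum>n<N. x n * c n) = (\<Sum>n<N. cmod (c n) powr q) powr (1 / q)"
begin

lemma norm_nonneg: "x \<in> carr X \<Longrightarrow> 0 \<le> vnorm X x"
  using norm_coord[of x 0] norm_ge_zero[of "x 0"] by linarith

lemma zero_carr: "(\<lambda>n. 0) \<in> carr X"
  using scale_closed[OF unit_carr, of 0] by simp

lemma norm_zero: "vnorm X (\<lambda>n. 0) = 0"
  using norm_scale[OF zero_carr, of 0] by simp

lemma diff_closed: "x \<in> carr X \<Longrightarrow> y \<in> carr X \<Longrightarrow> (\<lambda>n. x n - y n) \<in> carr X"
  using add_closed[OF _ scale_closed[of y "-1"], of x] by simp

lemma homogeneous: "homogeneous X"
  by (simp add: homogeneous_def vscale scale_closed norm_scale norm_nonneg)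

lemma vdist_eq: "x \<in> carr X \<Longrightarrow> y \<in> carr X \<Longrightarrow> vdist X x y = vnorm X (\<lambda>n. x n - y n)"
  by (simp add: vdist_def vadd vscale)

sublocale Metric_space "carr X" "vdist X"
proof
  show "0 \<le> vdist X x y" for x y
    by (cases "x \<in> carr X \<and> y \<in> carr X")
      (auto simp: vdist_eq norm_nonneg diff_closed, auto simp: vdist_def)
  show "vdist X x y = vdist X y x" for x y
  proof (cases "x \<in> carr X \<and> y \<in> carr X")
    case True
    then show ?thesis
      using norm_scale[OF diff_closed, of x y "-1"] by (simp add: vdist_eq)
  qed (auto simp: vdist_def)
  show "vdist X x y = 0 \<longleftrightarrow> x = y" if "x \<in> carr X" "y \<in> carr X" for x y
  proof
    assume "vdist X x y = 0"
    then have "cmod (x n - y n) \<le> 0" for n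
      using norm_coord[OF diff_closed, OF that, of n] that by (simp add: vdist_eq)
    then show "x = y"
      by (auto simp: fun_eq_iff)
  qed (use that in \<open>simp add: vdist_eq norm_zero\<close>)
  show "vdist X x z \<le> vdist X x y + vdist X y z"
    if "x \<in> carr X" "y \<in> carr X" "z \<in> carr X" for x y z
    using norm_triangle[OF diff_closed diff_closed, of x y y z] that by (simp add: vdist_eq)
qed

lemma topspace_norm_topology: "topspace (norm_topology X) = carr X"
  by (simp add: norm_topology_def)

text \<open>Coordinates are 1-Lipschitz by \<open>norm_coord\<close>.\<close>

lemma continuous_map_coord: "continuous_map (norm_topology X) euclidean (\<lambda>x. x n)"
  unfolding norm_topology_def continuous_map_from_metric
proof (intro conjI ballI allI impI)
  fix x :: "nat \<Rightarrow> complex" and U :: "complex set"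
  assume x: "x \<in> carr X" and "openin euclidean U \<and> x n \<in> U"
  then obtain r where r: "r > 0" "ball (x n) r \<subseteq> U"
    by (auto simp: open_contains_ball)
  have "y n \<in> U" if "y \<in> carr X" "vdist X x y < r" for y
  proof -
    have "cmod (x n - y n) < r"
      using norm_coord[OF diff_closed[OF x that(1)], of n] that x by (simp add: vdist_eq)
    then show ?thesis
      using r by (auto simp: dist_norm)
  qed
  then show "\<exists>r>0. \<forall>y. y \<in> carr X \<and> vdist X x y < r \<longrightarrow> y n \<in> U"
    using r by blast
qed simp

subsection \<open>The dual norm\<close>

lemma functional_truncation:
  assumes \<phi>: "linear_map X scalars \<phi>"
  shows "(\<lambda>n. if n < N then x n else 0) \<in> carr X \<and>
    \<phi> (\<lambda>n. if n < N then x n else 0) = (\<Sum>n<N. x n * \<phi> (unit_seq n))"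
proof (induction N)
  case 0
  have "\<phi> (\<lambda>n. 0) = 0"
    using linear_map_scale[OF \<phi> zero_carr, of 0] by (simp add: vscale scalars_def)
  then show ?case
    by (simp add: zero_carr)
next
  case (Suc N)
  have eq: "(\<lambda>n. if n < Suc N then x n else 0)
      = vadd X (\<lambda>n. if n < N then x n else 0) (vscale X (x N) (unit_seq N))"
    by (auto simp: vadd vscale unit_seq_def fun_eq_iff less_Suc_eq)
  have s: "vscale X (x N) (unit_seq N) \<in> carr X"
    by (simp add: vscale scale_closed unit_carr)
  have "vadd X (\<lambda>n. if n < N then x n else 0) (vscale X (x N) (unit_seq N)) \<in> carr X"
    using Suc s by (simp add: vadd add_closed)
  then show ?case
    unfolding eq using Suc s
    by (simp add: linear_map_add[OF \<phi>] linear_map_scale[OF \<phi>] unit_carr) (simp add: scalars_def)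
qed

lemma functional_bound:
  assumes "\<phi> \<in> carr (dual X)" "x \<in> carr X"
  shows "cmod (\<phi> x) \<le> vnorm (dual X) \<phi> * vnorm X x"
  using op_norm_bound[OF homogeneous homogeneous_scalars, of \<phi> x] assms
  by (simp add: dual_def) (simp add: scalars_def)

text \<open>A negative value would contradict \<open>functional_bound\<close> at
  \<open>unit_seq 0\<close>, whose norm is positive.\<close>

lemma dual_norm_nonneg:
  assumes "\<phi> \<in> carr (dual X)"
  shows "0 \<le> vnorm (dual X) \<phi>"
proof -
  have "1 \<le> vnorm X (unit_seq 0)"
    using norm_coord[OF unit_carr, of 0 0] by (simp add: unit_seq_def)
  then show ?thesis
    using functional_bound[OF assms unit_carr, of 0] norm_ge_zero[of "\<phi> (unit_seq 0)"]
    by (smt (verit) mult_neg_pos)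
qed

text \<open>This is the isometric embedding of the dual into l_q. The partial sums are bounded by
  testing on the extremal vectors of \<open>hoelder_sharp\<close>; the converse bound is Hoelder's
  inequality on truncations, extended by density of finite sequences.\<close>

lemma dual_norm_sums:
  assumes \<phi>: "\<phi> \<in> carr (dual X)"
  shows "(\<lambda>n. cmod (\<phi> (unit_seq n)) powr q) sums (vnorm (dual X) \<phi> powr q)"
proof -
  let ?c = "\<lambda>n. \<phi> (unit_seq n)" and ?M = "vnorm (dual X) \<phi>"
  let ?f = "\<lambda>n. cmod (?c n) powr q"
  have lin: "linear_map X scalars \<phi>"
    using \<phi> by (simp add: dual_def carr_bounded_maps)
  have partial: "(\<Sum>n<N. ?f n) \<le> ?M powr q" for N
  proof -
    obtain x where x: "x \<in> carr X" "vnorm X x \<le> 1" "\<forall>n\<ge>N. x n = 0"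
      and eq: "cmod (\<Sum>n<N. x n * ?c n) = (\<Sum>n<N. ?f n) powr (1 / q)"
      using hoelder_sharp[of N ?c] by blast
    have "(\<lambda>n. if n < N then x n else 0) = x"
      using x by (auto simp: fun_eq_iff)
    then have "cmod (\<phi> x) = (\<Sum>n<N. ?f n) powr (1 / q)"
      using functional_truncation[OF lin, of N x] eq by simp
    moreover have "?M * vnorm X x \<le> ?M * 1"
      using x dual_norm_nonneg[OF \<phi>] by (intro mult_left_mono)
    ultimately have "(\<Sum>n<N. ?f n) powr (1 / q) \<le> ?M"
      using functional_bound[OF \<phi> x(1)] by simp
    then have "((\<Sum>n<N. ?f n) powr (1 / q)) powr q \<le> ?M powr q"
      using q by (intro powr_mono2) auto
    then show ?thesis
      using q by (simp add: powr_powr sum_nonneg)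
  qed
  have summable: "summable ?f"
    using partial by (intro summableI_nonneg_bounded) auto
  let ?S = "(\<Sum>n. ?f n) powr (1 / q)"
  have upper: "cmod (\<phi> x) \<le> ?S * vnorm X x" if x: "x \<in> carr X" for x
  proof -
    let ?t = "\<lambda>N n. if n < N then 0 else x n"
    \<comment> \<open>Split x into its truncation, estimated by \<open>hoelder\<close>, and its
      tail, estimated by the operator norm; the second term disappears as N grows.\<close>
    have "cmod (\<phi> x) \<le> ?S * vnorm X x + ?M * vnorm X (?t N)" for N
    proof -
      let ?h = "\<lambda>n. if n < N then x n else 0"
      have h: "?h \<in> carr X" "\<phi> ?h = (\<Sum>n<N. x n * ?c n)"
        using functional_truncation[OF lin] by auto
      have "(\<lambda>n. x n - ?h n) = ?t N"
        by auto
      then have t: "?t N \<in> carr X"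
        using diff_closed[OF x h(1)] by simp
      have "vadd X ?h (?t N) = x"
        by (auto simp: vadd)
      then have "\<phi> x = \<phi> ?h + \<phi> (?t N)"
        using linear_map_add[OF lin h(1) t] by (simp add: scalars_def)
      then have "cmod (\<phi> x) \<le> cmod (\<Sum>n<N. x n * ?c n) + cmod (\<phi> (?t N))"
        using norm_triangle_ineq[of "\<phi> ?h" "\<phi> (?t N)"] by (simp only: h(2))
      also have "cmod (\<Sum>n<N. x n * ?c n) \<le> (\<Sum>n<N. ?f n) powr (1 / q) * vnorm X x"
        by (rule hoelder[OF x])
      also have "\<dots> \<le> ?S * vnorm X x"
        using q summable norm_nonneg[OF x]
        by (intro mult_right_mono powr_mono2 sum_le_suminf sum_nonneg) auto
      also have "cmod (\<phi> (?t N)) \<le> ?M * vnorm X (?t N)"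
        by (rule functional_bound[OF \<phi> t])
      finally show ?thesis
        by simp
    qed
    moreover have "(\<lambda>N. ?S * vnorm X x + ?M * vnorm X (?t N)) \<longlonglongrightarrow> ?S * vnorm X x + ?M * 0"
      by (intro tendsto_intros norm_tail x)
    ultimately show ?thesis
      by (intro LIMSEQ_le_const[where X = "\<lambda>N. ?S * vnorm X x + ?M * vnorm X (?t N)"]) auto
  qed
  have "?M \<le> ?S"
    unfolding dual_def vnorm_bounded_maps
  proof (rule cSUP_least)
    show "{x \<in> carr X. vnorm X x \<le> 1} \<noteq> {}"
      using zero_carr norm_zero by force
    fix x assume x: "x \<in> {x \<in> carr X. vnorm X x \<le> 1}"
    then have "cmod (\<phi> x) \<le> ?S * vnorm X x"
      using upper by simp
    also have "\<dots> \<le> ?S * 1"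
      using x by (intro mult_left_mono) auto
    finally show "vnorm scalars (\<phi> x) \<le> ?S"
      by (simp add: scalars_def)
  qed
  then have "?M powr q \<le> ?S powr q"
    using q dual_norm_nonneg[OF \<phi>] by (intro powr_mono2) auto
  also have "\<dots> = (\<Sum>n. ?f n)"
    using q summable by (simp add: powr_powr suminf_nonneg)
  finally have "(\<Sum>n. ?f n) = ?M powr q"
    using suminf_le_const[OF summable, of "?M powr q"] partial by simp
  then show ?thesis
    using summable by (simp add: sums_iff)
qed

subsection \<open>Operators with isometric adjoint\<close>

text \<open>The combination of two coordinate functionals with coefficients a and b, so that single
  rows, sums and differences are instances of one object. It is restricted to the carrier because
  elements of the dual are extensional.\<close>

definition coord_functional :: "complex \<Rightarrow> nat \<Rightarrow> complex \<Rightarrow> nat \<Rightarrow> (nat \<Rightarrow> complex) \<Rightarrow> complex" where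
  "coord_functional a i b k = (\<lambda>x\<in>carr X. a * x i + b * x k)"

lemma coord_functional_dual: "coord_functional a i b k \<in> carr (dual X)"
proof -
  have "cmod (a * x i + b * x k) \<le> (cmod a + cmod b) * vnorm X x" if "x \<in> carr X" for x
  proof -
    have "cmod (a * x i + b * x k) \<le> cmod a * cmod (x i) + cmod b * cmod (x k)"
      by (metis norm_mult norm_triangle_ineq)
    also have "\<dots> \<le> cmod a * vnorm X x + cmod b * vnorm X x"
      using norm_coord[OF that] by (intro add_mono mult_left_mono) auto
    finally show ?thesis
      by (simp add: distrib_right)
  qed
  then show ?thesis
    unfolding dual_def carr_bounded_maps
    by (auto simp: coord_functional_def linear_map_def scalars_def vadd vscale
        add_closed scale_closed algebra_simps intro!: exI[of _ "cmod a + cmod b"])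
qed

lemma coord_functional_unit:
  "coord_functional a i b k (unit_seq n) = a * unit_seq i n + b * unit_seq k n"
  unfolding coord_functional_def by (simp add: unit_carr) (simp add: unit_seq_def eq_commute)

lemma coord_functional_norm:
  assumes "i \<noteq> k"
  shows "vnorm (dual X) (coord_functional a i b k) powr q = cmod a powr q + cmod b powr q"
proof -
  have "(\<lambda>n. cmod (a * unit_seq i n + b * unit_seq k n) powr q)
      sums (\<Sum>n\<in>{i, k}. cmod (a * unit_seq i n + b * unit_seq k n) powr q)"
    by (rule sums_finite) (auto simp: unit_seq_def)
  then have "(\<lambda>n. cmod (coord_functional a i b k (unit_seq n)) powr q)
      sums (cmod a powr q + cmod b powr q)"
    using assms by (simp add: coord_functional_unit) (simp add: unit_seq_def)
  then show ?thesis
    using dual_norm_sums[OF coord_functional_dual] sums_unique2 by blast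
qed

text \<open>The rows of the matrix of \<open>T\<close> are the functionals \<open>T\<^sup>* e\<^sub>i\<^sup>*\<close>. Since \<open>T\<^sup>*\<close> is isometric, two of
  them satisfy Clarkson's inequality with equality, so they have disjoint supports.\<close>

lemma isometric_adjoint_columns:
  assumes iso: "isometry (dual X) (dual X) (adjoint_map X T)"
    and T: "T \<in> contractions X" and ik: "i \<noteq> k"
  shows "T (unit_seq j) i = 0 \<or> T (unit_seq j) k = 0"
proof -
  have lin: "linear_map X X T"
    using T by (simp add: contractions_def carr_bounded_maps)
  let ?A = "\<lambda>n. T (unit_seq n)"
  have sums: "(\<lambda>n. cmod (a * ?A n i + b * ?A n k) powr q) sums (cmod a powr q + cmod b powr q)"
    for a b
  proof -
    let ?\<phi> = "coord_functional a i b k"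
    have \<psi>: "adjoint_map X T ?\<phi> \<in> carr (dual X)"
      "vnorm (dual X) (adjoint_map X T ?\<phi>) = vnorm (dual X) ?\<phi>"
      using iso coord_functional_dual by (auto simp: isometry_def linear_map_def)
    have "adjoint_map X T ?\<phi> (unit_seq n) = a * ?A n i + b * ?A n k" for n
      using linear_map_carr[OF lin unit_carr, of n]
      by (simp add: adjoint_map_def coord_functional_dual compose_def unit_carr)
        (simp add: coord_functional_def)
    then show ?thesis
      using dual_norm_sums[OF \<psi>(1)] coord_functional_norm[OF ik] \<psi>(2) by simp
  qed
  show ?thesis
    \<comment> \<open>The coefficients (1,0), (0,1), (1,1), (1,-1) give the sums 1, 1, 2, 2, and 2 +
      2 = 2 * 1 + 2 * 1.\<close>
    using clarkson_sums_disjoint[OF q, of "\<lambda>n. ?A n i" 1 "\<lambda>n. ?A n k" 1 2 2]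
      sums[of 1 0] sums[of 0 1] sums[of 1 1] sums[of 1 "-1"] by simp
qed

subsection \<open>The strong operator topology\<close>

text \<open>Trades the operator norm for a pointwise inequality, the form in which new contractions
  are verified below.\<close>

lemma contractions_iff:
  "T \<in> contractions X \<longleftrightarrow> T \<in> extensional (carr X) \<and> linear_map X X T \<and>
    (\<forall>x\<in>carr X. vnorm X (T x) \<le> vnorm X x)" (is "_ \<longleftrightarrow> ?R")
proof
  assume T: "T \<in> contractions X"
  have "vnorm X (T x) \<le> vnorm X x" if "x \<in> carr X" for x
  proof -
    have "vnorm X (T x) \<le> vnorm (bounded_maps X X) T * vnorm X x"
      using T that by (intro op_norm_bound homogeneous) (auto simp: contractions_def)
    also have "\<dots> \<le> 1 * vnorm X x"
      using T norm_nonneg[OF that] by (intro mult_right_mono) (auto simp: contractions_def)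
    finally show ?thesis
      by simp
  qed
  then show ?R
    using T by (simp add: contractions_def carr_bounded_maps)
next
  assume R: ?R
  have "vnorm (bounded_maps X X) T \<le> 1"
    unfolding vnorm_bounded_maps
  proof (rule cSUP_least)
    show "{x \<in> carr X. vnorm X x \<le> 1} \<noteq> {}"
      using zero_carr norm_zero by force
  qed (use R in force)
  then show "T \<in> contractions X"
    using R by (auto simp: contractions_def carr_bounded_maps intro!: exI[of _ 1])
qed

lemma contraction_carr: "T \<in> contractions X \<Longrightarrow> x \<in> carr X \<Longrightarrow> T x \<in> carr X"
  using linear_map_carr[of X X T x] by (simp add: contractions_iff)

lemma topspace_SOT: "topspace (SOT X) = contractions X"
  using contraction_carr
  by (auto simp: SOT_def topspace_norm_topology PiE_iff)
    (auto simp: contractions_iff extensional_def)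

lemma continuous_map_SOT_entry:
  assumes "x \<in> carr X"
  shows "continuous_map (SOT X) euclidean (\<lambda>T. T x n)"
proof -
  have "continuous_map (SOT X) (norm_topology X) (\<lambda>T. T x)"
    unfolding SOT_def
    by (intro continuous_map_from_subtopology continuous_map_product_projection assms)
  from continuous_map_compose[OF this continuous_map_coord[of n]] show ?thesis
    by (simp add: o_def)
qed

text \<open>A matrix entry is SOT-continuous, so the set is a union of two closed zero sets.\<close>

lemma closedin_SOT_entries:
  "closedin (SOT X) {T \<in> contractions X. T (unit_seq j) i = 0 \<or> T (unit_seq j) k = 0}"
proof -
  have "closedin (SOT X) {T \<in> topspace (SOT X). T (unit_seq j) m \<in> {0}}" for m
    by (rule closedin_continuous_map_preimage[OF continuous_map_SOT_entry[OF unit_carr]]) simp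
  then have "closedin (SOT X) ({T \<in> contractions X. T (unit_seq j) i = 0} \<union>
      {T \<in> contractions X. T (unit_seq j) k = 0})"
    by (intro closedin_Un) (auto simp: topspace_SOT)
  then show ?thesis
    by (simp add: Collect_disj_eq conj_disj_distribL)
qed

lemma contraction_segment:
  assumes S: "S \<in> contractions X" and T: "T \<in> contractions X" and t: "0 \<le> t" "t \<le> 1"
  shows "(\<lambda>x\<in>carr X. \<lambda>n. of_real (1 - t) * T x n + of_real t * S x n) \<in> contractions X"
    (is "?U \<in> _")
proof -
  note S' = S[unfolded contractions_iff] and T' = T[unfolded contractions_iff]
  have TS: "T x \<in> carr X" "S x \<in> carr X" if "x \<in> carr X" for x
    using contraction_carr[OF T that] contraction_carr[OF S that] .
  have lin: "linear_map X X S" "linear_map X X T"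
    using S' T' by auto
  have "?U \<in> carr X \<rightarrow> carr X"
    using add_closed[OF scale_closed[OF TS(1)] scale_closed[OF TS(2)]] by simp
  then have "linear_map X X ?U"
    unfolding linear_map_def
    using lin[THEN linear_map_add] lin[THEN linear_map_scale] TS
    by (simp add: vadd vscale add_closed scale_closed fun_eq_iff algebra_simps)
  moreover have "vnorm X (?U x) \<le> vnorm X x" if x: "x \<in> carr X" for x
  proof -
    have "vnorm X (?U x) \<le> vnorm X (\<lambda>n. of_real (1 - t) * T x n) + vnorm X (\<lambda>n. of_real t * S x n)"
      using norm_triangle[OF scale_closed scale_closed, OF TS[OF x]] x by simp
    also have "\<dots> = (1 - t) * vnorm X (T x) + t * vnorm X (S x)"
      using TS[OF x] t norm_scale[of _ "of_real (1 - t)"] norm_scale[of _ "of_real t"]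
      by (simp del: of_real_diff)
    also have "\<dots> \<le> (1 - t) * vnorm X x + t * vnorm X x"
      using S' T' x t by (intro add_mono mult_left_mono) auto
    finally show ?thesis
      by (simp add: algebra_simps)
  qed
  ultimately show ?thesis
    by (simp add: contractions_iff)
qed

text \<open>At each x the difference from T x is (S x - T x) / (m + 1), which tends to 0 in norm;
  pointwise norm convergence is convergence in the product topology.\<close>

lemma limitin_SOT_segment:
  assumes S: "S \<in> contractions X" and T: "T \<in> contractions X"
  defines "U \<equiv> \<lambda>m. \<lambda>x\<in>carr X. \<lambda>n.
    of_real (1 - inverse (Suc m)) * T x n + of_real (inverse (Suc m)) * S x n"
  shows "limitin (SOT X) U T sequentially"
proof -
  have U: "U m \<in> contractions X" for m
    unfolding U_def by (intro contraction_segment S T) (auto simp: inverse_le_1_iff)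
  have "limitin (norm_topology X) (\<lambda>m. U m x) (T x) sequentially" if x: "x \<in> carr X" for x
    unfolding norm_topology_def limitin_metric
  proof (intro conjI allI impI)
    let ?d = "\<lambda>n. S x n - T x n"
    have d: "?d \<in> carr X"
      by (rule diff_closed[OF contraction_carr[OF S x] contraction_carr[OF T x]])
    have "vdist X (U m x) (T x) = inverse (Suc m) * vnorm X ?d" for m
    proof -
      have "U m x n - T x n = of_real (inverse (Suc m)) * ?d n" for n
        using x by (simp add: U_def left_diff_distrib right_diff_distrib)
      then have "vdist X (U m x) (T x) = vnorm X (\<lambda>n. of_real (inverse (Suc m)) * ?d n)"
        by (simp only: vdist_eq[OF contraction_carr[OF U x] contraction_carr[OF T x]])
      also have "\<dots> = inverse (Suc m) * vnorm X ?d"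
        using norm_scale[OF d, of "of_real (inverse (Suc m))"] by (simp only: norm_of_real) simp
      finally show ?thesis .
    qed
    moreover have "(\<lambda>m. inverse (Suc m) * vnorm X ?d) \<longlonglongrightarrow> 0 * vnorm X ?d"
      by (intro tendsto_intros LIMSEQ_inverse_real_of_nat)
    ultimately have "(\<lambda>m. vdist X (U m x) (T x)) \<longlonglongrightarrow> 0"
      by simp
    moreover fix e :: real assume "e > 0"
    ultimately have "\<forall>\<^sub>F m in sequentially. vdist X (U m x) (T x) < e"
      by (rule order_tendstoD)
    then show "\<forall>\<^sub>F m in sequentially. U m x \<in> carr X \<and> vdist X (U m x) (T x) < e"
      using contraction_carr[OF U x] by simp
  qed (rule contraction_carr[OF T x])
  moreover have "U m \<in> topspace (product_topology (\<lambda>_. norm_topology X) (carr X))" for m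
    using U[of m] contraction_carr[OF U[of m]]
    by (simp add: topspace_norm_topology PiE_iff) (simp add: contractions_iff)
  ultimately show ?thesis
    unfolding SOT_def limitin_subtopology limitin_componentwise
    using U T T[unfolded contractions_iff] by (simp only: always_eventually) simp
qed

text \<open>Two of the first three coordinates of \<open>T e\<^sub>0\<close> vanish; moving \<open>T\<close> slightly towards
  \<open>x \<mapsto> x\<^sub>0 (e\<^sub>k + e\<^sub>l) / 2\<close> makes both of them nonzero.\<close>

lemma interior_disjoint_columns:
  assumes "\<And>i k. i \<noteq> k \<Longrightarrow>
    D \<subseteq> {T \<in> contractions X. T (unit_seq 0) i = 0 \<or> T (unit_seq 0) k = 0}"
  shows "SOT X interior_of D = {}"
proof (rule ccontr)
  assume "SOT X interior_of D \<noteq> {}"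
  then obtain T where TW: "T \<in> SOT X interior_of D"
    by blast
  then have "T \<in> D"
    using interior_of_subset by fastforce
  then have T: "T \<in> contractions X"
    using assms[of 0 1] by auto
  have zero: "T (unit_seq 0) i = 0 \<or> T (unit_seq 0) k = 0" if "i \<noteq> k" for i k
    using assms[OF that] \<open>T \<in> D\<close> by blast
  obtain k l :: nat where kl: "k \<noteq> l" "T (unit_seq 0) k = 0" "T (unit_seq 0) l = 0"
  proof (cases "T (unit_seq 0) 0 = 0")
    case True
    then show ?thesis
      using zero[of 1 2] that[of 0 1] that[of 0 2] by auto
  next
    case False
    then show ?thesis
      using zero[of 0 1] zero[of 0 2] that[of 1 2] by auto
  qed
  \<comment> \<open>The weights 1/2 keep \<open>v\<close> in the unit ball by the triangle
    inequality, whichever norm X carries; \<open>norm_coord\<close> at 0 then makes \<open>R\<close>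
    a contraction.\<close>
  define v where "v = (\<lambda>n. unit_seq k n / 2 + unit_seq l n / 2)"
  have half: "(\<lambda>n. unit_seq m n / 2) \<in> carr X" "vnorm X (\<lambda>n. unit_seq m n / 2) \<le> 1 / 2" for m
    using scale_closed[OF unit_carr, of "1/2" m] norm_scale[OF unit_carr, of "1/2" m] norm_unit[of m]
    by auto
  have v: "v \<in> carr X" "vnorm X v \<le> 1"
    unfolding v_def using add_closed[OF half(1) half(1), of k l]
      norm_triangle[OF half(1) half(1), of k l] half(2)[of k] half(2)[of l] by auto
  define R where "R = (\<lambda>x\<in>carr X. \<lambda>n. x 0 * v n)"
  have "vnorm X (R x) \<le> vnorm X x" if "x \<in> carr X" for x
  proof -
    have "vnorm X (R x) = cmod (x 0) * vnorm X v"
      using that by (simp add: R_def norm_scale v)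
    also have "\<dots> \<le> vnorm X x * 1"
      using norm_coord[OF that, of 0] norm_nonneg[OF that] norm_nonneg[OF v(1)] v(2)
      by (intro mult_mono) auto
    finally show ?thesis
      by simp
  qed
  moreover have "linear_map X X R"
    unfolding linear_map_def R_def
    by (auto simp: vadd vscale add_closed scale_closed v fun_eq_iff algebra_simps)
  ultimately have R: "R \<in> contractions X"
    by (simp add: contractions_iff R_def)
  from limitin_SOT_segment[OF R T] TW have "\<forall>\<^sub>F m in sequentially.
    (\<lambda>x\<in>carr X. \<lambda>n. of_real (1 - inverse (Suc m)) * T x n + of_real (inverse (Suc m)) * R x n)
      \<in> SOT X interior_of D"
    unfolding limitin_def using openin_interior_of by blast
  then obtain m where "(\<lambda>x\<in>carr X. \<lambda>n. of_real (1 - inverse (Suc m)) * T x n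
      + of_real (inverse (Suc m)) * R x n) \<in> SOT X interior_of D"
    using eventually_happens trivial_limit_sequentially by blast
  then have "(\<lambda>x\<in>carr X. \<lambda>n. of_real (1 - inverse (Suc m)) * T x n
      + of_real (inverse (Suc m)) * R x n) \<in> D"
    using interior_of_subset by fastforce
  moreover have "complex_of_real (inverse (Suc m)) \<noteq> 0"
    by (simp only: of_real_eq_0_iff) simp
  \<comment> \<open>At k and l the entries of T vanish, so the perturbed operator has there a
    nonzero multiple of the entries of \<open>R\<close>.\<close>
  ultimately have "R (unit_seq 0) k = 0 \<or> R (unit_seq 0) l = 0"
    using assms[OF kl(1)] kl by (auto simp: unit_carr simp del: of_real_inverse of_real_of_nat_eq)
  moreover have "R (unit_seq 0) n = v n" for n
    by (simp add: R_def unit_carr) (simp add: unit_seq_def)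
  ultimately show False
    using kl(1) by (auto simp: v_def unit_seq_def)
qed

text \<open>For each pair of rows, the closed condition on T e_0 contains the isometric case and
  hence its closure, so the closure satisfies all of these conditions at once.\<close>

lemma nowhere_dense_isometric_adjoint:
  "nowhere_dense_in (SOT X) {T \<in> contractions X. isometry (dual X) (dual X) (adjoint_map X T)}"
    (is "nowhere_dense_in _ ?I")
proof -
  have "SOT X closure_of ?I \<subseteq> {T \<in> contractions X. T (unit_seq 0) i = 0 \<or> T (unit_seq 0) k = 0}"
    if "i \<noteq> k" for i k
    using isometric_adjoint_columns that
    by (intro closure_of_minimal closedin_SOT_entries) blast
  then show ?thesis
    unfolding nowhere_dense_in_def topspace_SOT using interior_disjoint_columns by blast
qed

end

section \<open>The space \<open>c\<^sub>0\<close>\<close>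

text \<open>Multiplication by the conjugate phase aligns all products in the extremal vectors below;
  z = 0 is covered because division by 0 gives 0.\<close>

lemma sgn_cnj_mult: "cnj (sgn z) * z = of_real (cmod z)"
proof -
  have "cnj (sgn z) * z = z * cnj z / of_real (cmod z)"
    by (simp add: sgn_eq mult.commute)
  also have "z * cnj z = of_real (cmod z) * of_real (cmod z)"
    by (simp only: complex_norm_square[symmetric] power2_eq_square of_real_mult)
  finally show ?thesis
    by simp
qed

lemma seq_space_c0: "seq_space c0 1"
proof -
  have bdd: "bdd_above (range (\<lambda>n. cmod (x n)))" if "x \<in> carr c0" for x
  proof -
    have "Bseq x"
      using that by (auto simp: c0_def intro: convergentI convergent_imp_Bseq)
    then show ?thesis
      by (auto simp: Bseq_def bdd_above_def)
  qed
  have norm_le: "vnorm c0 x \<le> B" if "\<And>n. cmod (x n) \<le> B" for x B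
    using that by (auto simp: c0_def intro!: cSUP_least)
  have coord: "cmod (x n) \<le> vnorm c0 x" if "x \<in> carr c0" for x n
    using cSUP_upper[OF _ bdd[OF that], of n] by (simp add: c0_def)
  have finite_support: "x \<in> carr c0" if "\<And>n. N \<le> n \<Longrightarrow> x n = 0" for x N
    using that by (auto simp: c0_def intro!: tendsto_eventually eventually_sequentiallyI[of N])
  have scale_closed: "(\<lambda>n. a * x n) \<in> carr c0" if "x \<in> carr c0" for a x
    using that tendsto_mult_right_zero[of x sequentially a] by (simp add: c0_def)
  show ?thesis
  proof
    show "vadd c0 = (\<lambda>x y n. x n + y n)" "vscale c0 = (\<lambda>a x n. a * x n)"
      by (simp_all add: c0_def)
    show "(\<lambda>n. x n + y n) \<in> carr c0" if "x \<in> carr c0" "y \<in> carr c0" for x y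
      using that tendsto_add_zero by (auto simp: c0_def)
    show "(\<lambda>n. a * x n) \<in> carr c0" if "x \<in> carr c0" for a x
      by (rule scale_closed[OF that])
    show "cmod (x n) \<le> vnorm c0 x" if "x \<in> carr c0" for x n
      by (rule coord[OF that])
    show "vnorm c0 (\<lambda>n. a * x n) = cmod a * vnorm c0 x" if x: "x \<in> carr c0" for a x
    proof (rule antisym)
      show "vnorm c0 (\<lambda>n. a * x n) \<le> cmod a * vnorm c0 x"
        by (intro norm_le) (simp add: norm_mult mult_left_mono coord[OF x])
      show "cmod a * vnorm c0 x \<le> vnorm c0 (\<lambda>n. a * x n)"
      proof (cases "a = 0")
        case True
        then show ?thesis
          using coord[OF scale_closed[OF x, of a], of 0] by simp
      next
        case False
        have "vnorm c0 x \<le> vnorm c0 (\<lambda>n. a * x n) / cmod a"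
          using coord[OF scale_closed[OF x, of a]] False
          by (intro norm_le) (simp add: norm_mult field_simps)
        then show ?thesis
          using False by (simp add: field_simps)
      qed
    qed
    show "vnorm c0 (\<lambda>n. x n + y n) \<le> vnorm c0 x + vnorm c0 y"
      if "x \<in> carr c0" "y \<in> carr c0" for x y
      using coord that by (intro norm_le norm_triangle_mono)
    show "unit_seq j \<in> carr c0" for j
      by (rule finite_support[of "Suc j"]) (simp add: unit_seq_def)
    show "vnorm c0 (unit_seq j) \<le> 1" for j
      by (rule norm_le) (simp add: unit_seq_def)
    show "(\<lambda>N. vnorm c0 (\<lambda>n. if n < N then 0 else x n)) \<longlonglongrightarrow> 0" if x: "x \<in> carr c0" for x
    proof (rule LIMSEQ_I)
      fix r :: real assume r: "0 < r"
      \<comment> \<open>The supremum weakens the strict bound to \<le>, so r/2 is used to stay below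
        r.\<close>
      obtain M where M: "\<And>n. n \<ge> M \<Longrightarrow> cmod (x n) < r / 2"
        using LIMSEQ_D[of x 0 "r/2"] x r by (auto simp: c0_def)
      have "norm (vnorm c0 (\<lambda>n. if n < N then 0 else x n) - 0) < r" if "N \<ge> M" for N
      proof -
        let ?t = "\<lambda>n. if n < N then 0 else x n"
        have "vnorm c0 ?t \<le> r / 2"
          using M that r by (intro norm_le) (auto simp: less_imp_le)
        moreover have "\<forall>\<^sub>F n in sequentially. ?t n = x n"
          by (rule eventually_sequentiallyI[of N]) simp
        from tendsto_cong[OF this] have "?t \<in> carr c0"
          using x by (simp add: c0_def)
        then have "0 \<le> vnorm c0 ?t"
          using coord[of ?t 0] norm_ge_zero order_trans by blast
        ultimately show ?thesis
          using r by simp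
      qed
      then show "\<exists>M. \<forall>N\<ge>M. norm (vnorm c0 (\<lambda>n. if n < N then 0 else x n) - 0) < r"
        by blast
    qed
    show "cmod (\<Sum>n<N. x n * c n) \<le> (\<Sum>n<N. cmod (c n) powr 1) powr (1 / 1) * vnorm c0 x"
      if x: "x \<in> carr c0" for x c N
    proof -
      have "cmod (\<Sum>n<N. x n * c n) \<le> (\<Sum>n<N. cmod (c n) * vnorm c0 x)"
        using coord[OF x] by (intro sum_norm_le) (simp add: norm_mult mult.commute[of "cmod (x _)"] mult_left_mono)
      then show ?thesis
        by (simp add: sum_distrib_right sum_nonneg)
    qed
    show "\<exists>x\<in>carr c0. vnorm c0 x \<le> 1 \<and> (\<forall>n\<ge>N. x n = 0) \<and>
      cmod (\<Sum>n<N. x n * c n) = (\<Sum>n<N. cmod (c n) powr 1) powr (1 / 1)" for N c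
    proof (intro bexI conjI)
      \<comment> \<open>Conjugate phases turn every product into |c n|, and phases have modulus at
        most 1; cutting off at N puts the vector into c_0.\<close>
      let ?x = "\<lambda>n. if n < N then cnj (sgn (c n)) else 0"
      show "vnorm c0 ?x \<le> 1"
        by (rule norm_le) (simp add: norm_sgn)
      have "(\<Sum>n<N. ?x n * c n) = of_real (\<Sum>n<N. cmod (c n))"
        by (simp add: sgn_cnj_mult)
      then show "cmod (\<Sum>n<N. ?x n * c n) = (\<Sum>n<N. cmod (c n) powr 1) powr (1 / 1)"
        by (simp add: sum_nonneg del: of_real_sum)
      show "?x \<in> carr c0"
        by (rule finite_support[of N]) simp
    qed simp
  qed simp_all
qed

section \<open>The spaces \<open>\<ell>\<^sub>p\<close>\<close>

lemma lp_carr: "x \<in> carr (lp p) \<longleftrightarrow> summable (\<lambda>n. cmod (x n) powr p)"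
  by (simp add: lp_def)

lemma lp_norm: "vnorm (lp p) x = (\<Sum>n. cmod (x n) powr p) powr (1 / p)"
  by (simp add: lp_def)

context
  fixes p :: real
  assumes p: "1 \<le> p"
begin

lemma lp_sums: "x \<in> carr (lp p) \<Longrightarrow> (\<lambda>n. cmod (x n) powr p) sums (vnorm (lp p) x powr p)"
  using p by (simp add: lp_carr lp_norm powr_powr suminf_nonneg summable_sums)

lemma lp_norm_nonneg: "0 \<le> vnorm (lp p) x"
  by (simp add: lp_norm)

lemma lp_norm_le:
  assumes "x \<in> carr (lp p)" "0 \<le> B" "(\<Sum>n. cmod (x n) powr p) \<le> B powr p"
  shows "vnorm (lp p) x \<le> B"
proof -
  have "(\<Sum>n. cmod (x n) powr p) powr (1 / p) \<le> (B powr p) powr (1 / p)"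
    using assms p by (intro powr_mono2) (auto simp: lp_carr suminf_nonneg)
  then show ?thesis
    using assms p by (simp add: lp_norm powr_powr)
qed

lemma lp_norm_eqI:
  assumes "(\<lambda>n. cmod (x n) powr p) sums (B powr p)" "0 \<le> B"
  shows "x \<in> carr (lp p)" "vnorm (lp p) x = B"
  using assms p by (auto simp: lp_carr lp_norm powr_powr sums_iff)

lemma lp_scale:
  assumes "x \<in> carr (lp p)"
  shows "(\<lambda>n. a * x n) \<in> carr (lp p)" "vnorm (lp p) (\<lambda>n. a * x n) = cmod a * vnorm (lp p) x"
  using lp_norm_eqI[of "\<lambda>n. a * x n" "cmod a * vnorm (lp p) x"]
    sums_mult[OF lp_sums[OF assms], of "cmod a powr p"]
  by (auto simp: norm_mult powr_mult lp_norm_nonneg)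

text \<open>Minkowski's inequality by convexity: x/a and y/b are averaged with the weights a/(a+b)
  and b/(a+b). Bounds strictly above the norms make a and b positive even for zero vectors.\<close>

lemma lp_add_bound:
  assumes x: "x \<in> carr (lp p)" and y: "y \<in> carr (lp p)"
    and a: "vnorm (lp p) x < a" and b: "vnorm (lp p) y < b"
  shows "(\<lambda>n. x n + y n) \<in> carr (lp p)" "vnorm (lp p) (\<lambda>n. x n + y n) \<le> a + b"
proof -
  have pos: "0 < a" "0 < b"
    using a b lp_norm_nonneg[of x] lp_norm_nonneg[of y] by linarith+
  let ?t = "b / (a + b)"
  have t: "0 \<le> ?t" "?t \<le> 1" "1 - ?t = a / (a + b)"
    using pos by (auto simp: field_simps)
  let ?g = "\<lambda>n. (a + b) powr p *
    ((1 - ?t) / a powr p * cmod (x n) powr p + ?t / b powr p * cmod (y n) powr p)"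
  have le: "cmod (x n + y n) powr p \<le> ?g n" for n
  proof -
    have "cmod (x n + y n) \<le> cmod (x n) + cmod (y n)"
      by (rule norm_triangle_ineq)
    also have "\<dots> = (a + b) * ((1 - ?t) * (cmod (x n) / a) + ?t * (cmod (y n) / b))"
      unfolding t(3) using pos by (simp add: distrib_left)
    finally have "cmod (x n + y n) powr p
        \<le> ((a + b) * ((1 - ?t) * (cmod (x n) / a) + ?t * (cmod (y n) / b))) powr p"
      using p by (intro powr_mono2) auto
    also have "\<dots> = (a + b) powr p * ((1 - ?t) * (cmod (x n) / a) + ?t * (cmod (y n) / b)) powr p"
      using pos t by (intro powr_mult)
    also have "\<dots> \<le> (a + b) powr p *
        ((1 - ?t) * (cmod (x n) / a) powr p + ?t * (cmod (y n) / b) powr p)"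
      using convex_onD[OF convex_on_powr[OF p] t(1,2), of "cmod (x n) / a" "cmod (y n) / b"] pos
      by (intro mult_left_mono) auto
    finally show ?thesis
      using pos by (simp add: powr_divide)
  qed
  have g: "?g sums ((a + b) powr p * ((1 - ?t) / a powr p * vnorm (lp p) x powr p
      + ?t / b powr p * vnorm (lp p) y powr p))" (is "_ sums ?G")
    by (intro sums_mult sums_add lp_sums x y)
  show closed: "(\<lambda>n. x n + y n) \<in> carr (lp p)"
    unfolding lp_carr using le by (intro summable_comparison_test'[OF sums_summable[OF g], of 0]) simp
  have "(\<Sum>n. cmod (x n + y n) powr p) \<le> ?G"
    using suminf_le[of "\<lambda>n. cmod (x n + y n) powr p" ?g] le closed g by (simp add: lp_carr sums_iff)
  also have "\<dots> \<le> (a + b) powr p * ((1 - ?t) / a powr p * a powr p + ?t / b powr p * b powr p)"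
    using a b p pos t lp_norm_nonneg
    by (intro mult_left_mono add_mono powr_mono2) auto
  also have "\<dots> = (a + b) powr p"
    using pos by simp
  finally show "vnorm (lp p) (\<lambda>n. x n + y n) \<le> a + b"
    using pos closed by (intro lp_norm_le) auto
qed

text \<open>Take the bounds in \<open>lp_add_bound\<close> larger than the norms by e/2 each and let
  e tend to 0.\<close>

lemma lp_add:
  assumes x: "x \<in> carr (lp p)" and y: "y \<in> carr (lp p)"
  shows "(\<lambda>n. x n + y n) \<in> carr (lp p)"
    "vnorm (lp p) (\<lambda>n. x n + y n) \<le> vnorm (lp p) x + vnorm (lp p) y"
proof -
  show "(\<lambda>n. x n + y n) \<in> carr (lp p)"
    by (rule lp_add_bound[OF x y less_add_one less_add_one])
  show "vnorm (lp p) (\<lambda>n. x n + y n) \<le> vnorm (lp p) x + vnorm (lp p) y"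
  proof (rule field_le_epsilon)
    fix e :: real assume "0 < e"
    then show "vnorm (lp p) (\<lambda>n. x n + y n) \<le> vnorm (lp p) x + vnorm (lp p) y + e"
      using lp_add_bound(2)[OF x y, of "vnorm (lp p) x + e / 2" "vnorm (lp p) y + e / 2"] by simp
  qed
qed

lemma lp_partial_sum_le:
  assumes "x \<in> carr (lp p)"
  shows "(\<Sum>n\<in>I. cmod (x n) powr p) \<le> vnorm (lp p) x powr p"
  using sum_le_suminf[of "\<lambda>n. cmod (x n) powr p" I] lp_sums[OF assms]
  by (cases "finite I") (auto simp: sums_iff)

lemma lp_coord:
  assumes "x \<in> carr (lp p)"
  shows "cmod (x n) \<le> vnorm (lp p) x"
  using lp_partial_sum_le[OF assms, of "{n}"] p lp_norm_nonneg[of x]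
    powr_less_mono2[of p "vnorm (lp p) x" "cmod (x n)"] by fastforce

lemma lp_finite_support:
  assumes "\<And>n. N \<le> n \<Longrightarrow> x n = 0"
  shows "x \<in> carr (lp p)" "vnorm (lp p) x = (\<Sum>n<N. cmod (x n) powr p) powr (1 / p)"
  using sums_finite[of "{..<N}" "\<lambda>n. cmod (x n) powr p"] assms
  by (auto simp: lp_carr lp_norm sums_iff)

lemma lp_tail:
  assumes x: "x \<in> carr (lp p)"
  shows "(\<lambda>N. vnorm (lp p) (\<lambda>n. if n < N then 0 else x n)) \<longlonglongrightarrow> 0"
proof -
  let ?f = "\<lambda>n. cmod (x n) powr p"
  have summable: "summable ?f"
    using x by (simp add: lp_carr)
  have "(\<lambda>n. cmod (if n < N then 0 else x n) powr p) sums (suminf ?f - (\<Sum>n<N. ?f n))" for N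
  proof -
    have "(\<lambda>n. ?f n - (if n \<in> {..<N} then ?f n else 0)) sums (suminf ?f - (\<Sum>n<N. ?f n))"
      by (intro sums_diff sums_If_finite_set summable_sums summable) simp
    then show ?thesis
      by (rule sums_cong[THEN iffD1, rotated]) simp
  qed
  then have eq: "vnorm (lp p) (\<lambda>n. if n < N then 0 else x n)
      = (suminf ?f - (\<Sum>n<N. ?f n)) powr (1 / p)" for N
    unfolding lp_norm by (simp only: sums_iff)
  have "(\<lambda>N. suminf ?f - (\<Sum>n<N. ?f n)) \<longlonglongrightarrow> suminf ?f - suminf ?f"
    by (intro tendsto_intros summable_LIMSEQ summable)
  then have "(\<lambda>N. (suminf ?f - (\<Sum>n<N. ?f n)) powr (1 / p)) \<longlonglongrightarrow> 0 powr (1 / p)"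
    \<comment> \<open>The base tends to 0, where continuity of \<open>powr\<close> rests on the
      positive exponent and on the base staying nonnegative.\<close>
    using p summable by (intro tendsto_powr') (auto intro!: sum_le_suminf always_eventually)
  then show ?thesis
    by (simp add: eq)
qed

end

text \<open>Normalise both families to norm 1 and apply Young's inequality termwise; the sum of the
  right-hand sides is 1/p + 1/q = 1.\<close>

lemma hoelder_sum:
  fixes f g :: "nat \<Rightarrow> real"
  assumes pq: "1 < p" "1 < q" "1 / p + 1 / q = 1" and I: "finite I"
    and f: "\<And>i. i \<in> I \<Longrightarrow> 0 \<le> f i" and g: "\<And>i. i \<in> I \<Longrightarrow> 0 \<le> g i"
  shows "(\<Sum>i\<in>I. f i * g i) \<le> (\<Sum>i\<in>I. f i powr p) powr (1 / p) * (\<Sum>i\<in>I. g i powr q) powr (1 / q)"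
    (is "_ \<le> ?A powr _ * ?B powr _")
proof (cases "?A = 0 \<or> ?B = 0")
  case True
  then have "(\<forall>i\<in>I. f i = 0) \<or> (\<forall>i\<in>I. g i = 0)"
    using I by (auto simp: sum_nonneg_eq_0_iff)
  then show ?thesis
    by (auto simp: sum_nonneg)
next
  case False
  then have pos: "0 < ?A" "0 < ?B"
    by (auto simp: less_le sum_nonneg)
  let ?a = "?A powr (1 / p)" and ?b = "?B powr (1 / q)"
  have "(\<Sum>i\<in>I. (f i / ?a) * (g i / ?b)) \<le> (\<Sum>i\<in>I. f i powr p / ?A / p + g i powr q / ?B / q)"
  proof (rule sum_mono)
    fix i assume i: "i \<in> I"
    have "(f i / ?a) * (g i / ?b) \<le> (f i / ?a) powr p / p + (g i / ?b) powr q / q"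
      using i f g pq by (intro Youngs_inequality) auto
    then show "(f i / ?a) * (g i / ?b) \<le> f i powr p / ?A / p + g i powr q / ?B / q"
      using i f g pq pos by (simp add: powr_divide powr_powr)
  qed
  also have "\<dots> = ?A / ?A / p + ?B / ?B / q"
    by (simp only: sum.distrib sum_divide_distrib)
  also have "\<dots> = 1"
    using pos pq by simp
  finally have "(\<Sum>i\<in>I. f i * g i) / (?a * ?b) \<le> 1"
    by (simp add: sum_divide_distrib)
  then show ?thesis
    using pos by (simp add: divide_le_eq)
qed

lemma lp_hoelder:
  assumes pq: "1 < p" "1 < q" "1 / p + 1 / q = 1" and x: "x \<in> carr (lp p)"
  shows "cmod (\<Sum>n<N. x n * c n) \<le> (\<Sum>n<N. cmod (c n) powr q) powr (1 / q) * vnorm (lp p) x"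
proof -
  have "cmod (\<Sum>n<N. x n * c n) \<le> (\<Sum>n<N. cmod (x n) * cmod (c n))"
    by (rule sum_norm_le) (simp add: norm_mult)
  also have "\<dots> \<le> (\<Sum>n<N. cmod (x n) powr p) powr (1 / p) * (\<Sum>n<N. cmod (c n) powr q) powr (1 / q)"
    by (rule hoelder_sum[OF pq]) auto
  also have "(\<Sum>n<N. cmod (x n) powr p) powr (1 / p) \<le> (vnorm (lp p) x powr p) powr (1 / p)"
    using lp_partial_sum_le[OF _ x] pq by (intro powr_mono2 sum_nonneg) auto
  finally show ?thesis
    using pq by (simp add: powr_powr lp_norm_nonneg mult_right_mono mult.commute)
qed

lemma lp_hoelder_sharp:
  assumes pq: "1 < p" "1 < q" "1 / p + 1 / q = 1"
  shows "\<exists>x\<in>carr (lp p). vnorm (lp p) x \<le> 1 \<and> (\<forall>n\<ge>N. x n = 0) \<and>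
    cmod (\<Sum>n<N. x n * c n) = (\<Sum>n<N. cmod (c n) powr q) powr (1 / q)"
proof -
  let ?A = "\<Sum>n<N. cmod (c n) powr q"
  have exps: "(q - 1) * p = q" "1 - 1 / p = 1 / q"
    using pq by (auto simp: field_simps)
  \<comment> \<open>The equality case of Hoelder: |x n|^p is proportional to |c n|^q since (q-1)p =
    q, the phases are aligned, and A^(-1/p) normalises. The pairing is then A^(1-1/p) = A^(1/q). If
    A = 0, then 0 \<open>powr\<close> anything is 0 and x = 0.\<close>
  define x where "x = (\<lambda>n. if n < N
    then of_real (?A powr (- 1 / p) * cmod (c n) powr (q - 1)) * cnj (sgn (c n)) else 0)"
  have cmod_x: "cmod (x n) powr p = inverse ?A * cmod (c n) powr q" if "n < N" for n
  proof (cases "c n = 0")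
    case False
    then have "cmod (x n) = ?A powr (- 1 / p) * cmod (c n) powr (q - 1)"
      unfolding x_def if_P[OF that]
      by (simp only: norm_mult norm_of_real complex_mod_cnj norm_sgn) (simp add: abs_mult)
    then have "cmod (x n) powr p
        = (?A powr (- 1 / p)) powr p * (cmod (c n) powr (q - 1)) powr p"
      by (simp only: powr_mult powr_ge_zero)
    also have "\<dots> = ?A powr (- 1) * cmod (c n) powr q"
      unfolding powr_powr using pq exps(1) by simp
    finally show ?thesis
      by (simp add: powr_minus sum_nonneg)
  qed (use that pq in \<open>simp add: x_def\<close>)
  have supp: "x n = 0" if "N \<le> n" for n
    using that by (simp add: x_def)
  have "(\<Sum>n<N. cmod (x n) powr p) = inverse ?A * ?A"
    by (simp add: cmod_x sum_distrib_left)
  also have "\<dots> \<le> 1"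
    by (cases "?A = 0") auto
  finally have "(\<Sum>n<N. cmod (x n) powr p) powr (1 / p) \<le> 1 powr (1 / p)"
    using pq by (intro powr_mono2 sum_nonneg) auto
  then have x: "x \<in> carr (lp p)" "vnorm (lp p) x \<le> 1"
    using lp_finite_support[of p N x] supp pq by auto
  have "x n * c n = of_real (?A powr (- 1 / p) * cmod (c n) powr q)" if "n < N" for n
  proof -
    have "x n * c n = of_real (?A powr (- 1 / p) * (cmod (c n) powr (q - 1) * cmod (c n)))"
      unfolding x_def if_P[OF that] by (simp only: mult.assoc sgn_cnj_mult of_real_mult)
    also have "cmod (c n) powr (q - 1) * cmod (c n) = cmod (c n) powr q"
      using powr_add[of "cmod (c n)" "q - 1" 1] by (cases "c n = 0") auto
    finally show ?thesis .
  qed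
  then have "(\<Sum>n<N. x n * c n) = of_real (?A powr (- 1 / p) * ?A)"
    by (simp add: sum_distrib_left)
  moreover have "?A powr (- 1 / p) * ?A = ?A powr (1 / q)"
    using powr_add[of ?A "- 1 / p" 1] exps(2) by (cases "?A = 0") (auto simp: sum_nonneg)
  ultimately have "cmod (\<Sum>n<N. x n * c n) = ?A powr (1 / q)"
    by (simp only: norm_of_real) simp
  with x supp show ?thesis
    by blast
qed

text \<open>\<open>p / (p - 1)\<close> is the conjugate exponent; it equals 2 exactly for p =
  2.\<close>

lemma seq_space_lp:
  assumes p: "1 < p" "p \<noteq> 2"
  shows "seq_space (lp p) (p / (p - 1))"
proof -
  let ?q = "p / (p - 1)"
  have p1: "1 \<le> p"
    using p by simp
  have pq: "1 < p" "1 < ?q" "1 / p + 1 / ?q = 1"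
    using p by (auto simp: field_simps)
  have unit: "unit_seq j \<in> carr (lp p)" "vnorm (lp p) (unit_seq j) = 1" for j
    using lp_finite_support[OF p1, of "Suc j" "unit_seq j"] by (simp_all add: unit_seq_def)
  show ?thesis
  proof
    show "vadd (lp p) = (\<lambda>x y n. x n + y n)" "vscale (lp p) = (\<lambda>a x n. a * x n)"
      by (simp_all add: lp_def)
    show "0 < ?q" "?q \<noteq> 2"
      using p by (auto simp: field_simps)
    show "vnorm (lp p) (unit_seq j) \<le> 1" for j
      by (simp add: unit)
  qed (fact lp_add[OF p1] lp_scale[OF p1] unit lp_coord[OF p1] lp_tail[OF p1]
      lp_hoelder[OF pq] lp_hoelder_sharp[OF pq])+
qed

section \<open>Isometric adjoints\<close>

lemma typical_if_nowhere_dense: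
  assumes "topspace (SOT X) = contractions X"
    and "nowhere_dense_in (SOT X) {T \<in> contractions X. P T}"
  shows "typical_contraction X (\<lambda>T. \<not> P T)"
  unfolding typical_contraction_def comeager_in_def
  using assms by (auto intro!: exI[of _ "{{T \<in> contractions X. P T}}"])

theorem proposition5p1:
  fixes X :: "(nat \<Rightarrow> complex) nspace"
  assumes "X = c0 \<or> (\<exists>p::real. 1 < p \<and> p \<noteq> 2 \<and> X = lp p)"
  shows "nowhere_dense_in (SOT X)
           {T \<in> contractions X. isometry (dual X) (dual X) (adjoint_map X T)} \<and>
         typical_contraction X (\<lambda>T. \<not> isometry (dual X) (dual X) (adjoint_map X T))"
proof -
  obtain q where "seq_space X q"
    using assms seq_space_c0 seq_space_lp by blast
  then interpret seq_space X q .
  show ?thesis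
    by (intro conjI nowhere_dense_isometric_adjoint
        typical_if_nowhere_dense[OF topspace_SOT nowhere_dense_isometric_adjoint])
qed

end
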